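(* Let $G$ be a level transitive spinal Hanoi towers group acting on $\mathcal T_d$. Then $J\leq G$ if and only if $G$ is regular branch over $G'$ and $D\leq\Psi(\mathrm{St}_G(1))$.
   Context: Tree and conventions. $\mathcal T_d$ is the $d$-regular rooted tree whose vertices are the finite words over $X=\{1,\dots,d\}$. Automorphisms and permutations act on the right and products are read from left to right. For $g\in\mathrm{Aut}(\mathcal T_d)$ and a vertex $v$, the section $g|_v$ is defined by $(vw)^g=v^g\,w^{g|_v}$. We write $\psi(g)=(g|_1,\dots,g|_d)\tau$, where $\tau\in\mathrm{Sym}(d)$ (the root permutation) is the action of $g$ on the first level. $\mathrm{St}(1)$ is the pointwise stabilizer of the first level in $\mathrm{Aut}(\mathcal T_d)$ and $\mathrm{St}_G(1)=G\cap\mathrm{St}(1)$. Spinal Hanoi towers groups. Given $\sigma_1,\dots,\sigma_d\in\mathrm{Sym}(d)$ with $\sigma_i\neq 1$ and $\sigma_i$ fixing $i$ for each $i$, let $a_i\in\mathrm{Aut}(\mathcal T_d)$ be defined recursively by $\psi(a_i)=(1,\dots,1,a_i,1,\dots,1)\sigma_i$, with $a_i$ in the $i$-th coordinate. Any group $G=\langle a_1,\dots,a_d\rangle$ of this form is a spinal Hanoi towers group; set $P=\langle\sigma_1,\dots,\sigma_d\rangle$. The order $o(a_i)$ is finite. All sections of elements of $G$ lie in $G$. $J$ is the subgroup of $\mathrm{Aut}(\mathcal T_d)$ generated by all $g\in\mathrm{St}(1)$ for which there are $h\in G$ and two distinct coordinates $p,q$ such that $\psi(g)$ has $h$ in coordinate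 $p$, $h^{-1}$ in coordinate $q$, and trivial entries elsewhere. Put $A=\prod_{i=1}^d\mathbb Z/o(a_i)\mathbb Z$. $\varepsilon:G\to A$ is the (well-defined) surjective homomorphism sending $a_i$ to the $i$-th standard generator; its kernel is $G'$. $\Psi:G\to A^d\rtimes P$ is the homomorphism $\Psi(g)=(\varepsilon(g|_1),\dots,\varepsilon(g|_d))\tau$, where $\tau$ is the root permutation of $g$; it maps $\mathrm{St}_G(1)$ into $A^d$. $D\le A^d$ is the kernel of the sum map $A^d\to A$, $(v_1,\dots,v_d)\mapsto v_1+\cdots+v_d$. $G$ is level transitive if it is transitive on each level. $G$ is regular branch over $K\le G$ if $G$ is level transitive, $|G:K|<\infty$, and $K\times\cdots\times K$ ($d$ factors) is contained in $\psi(K\cap\mathrm{St}(1))$. *)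

theory Defs
  imports "HOL-Algebra.Algebra"
begin

text \<open>
  The alphabet \<open>X\<close> is a finite type \<open>'x\<close> (so \<open>d = CARD('x)\<close>), and the vertices of the
  \<open>d\<close>-regular rooted tree are the words over it, the root being the empty word.
\<close>

definition child :: "'x list \<Rightarrow> 'x list \<Rightarrow> bool" where
  "child u v \<longleftrightarrow> (\<exists>x. v = u @ [x])"

definition tree_automorphisms :: "('x list \<Rightarrow> 'x list) set" where
  "tree_automorphisms = {g. bij g \<and> g [] = [] \<and> (\<forall>u v. child (g u) (g v) \<longleftrightarrow> child u v)}"

text \<open>Automorphisms act on the right, so the product of \<open>g\<close> and \<open>h\<close> is \<open>g\<close> followed by \<open>h\<close>.\<close>

definition Aut_tree :: "('x list \<Rightarrow> 'x list) monoid" where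
  "Aut_tree = \<lparr>carrier = tree_automorphisms, monoid.mult = (\<lambda>g h. h \<circ> g), one = id\<rparr>"

text \<open>
  \<open>section_at g v\<close> is the section of \<open>g\<close> at \<open>v\<close>; its defining equation
  \<open>g (v @ w) = g v @ section_at g v w\<close> is lemma \<open>section_at_append\<close> below.
\<close>

definition section_at :: "('x list \<Rightarrow> 'x list) \<Rightarrow> 'x list \<Rightarrow> ('x list \<Rightarrow> 'x list)" where
  "section_at g v = (\<lambda>w. drop (length (g v)) (g (v @ w)))"

definition root_perm :: "('x list \<Rightarrow> 'x list) \<Rightarrow> 'x \<Rightarrow> 'x" where
  "root_perm g = (\<lambda>x. hd (g [x]))"

definition psi :: "('x list \<Rightarrow> 'x list) \<Rightarrow> ('x \<Rightarrow> 'x list \<Rightarrow> 'x list) \<times> ('x \<Rightarrow> 'x)" where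
  "psi g = ((\<lambda>x. section_at g [x]), root_perm g)"

definition St1 :: "('x list \<Rightarrow> 'x list) set" where
  "St1 = {g \<in> carrier Aut_tree. \<forall>x. g [x] = [x]}"

definition level_transitive :: "('x list \<Rightarrow> 'x list) set \<Rightarrow> bool" where
  "level_transitive G \<longleftrightarrow> (\<forall>u v. length u = length v \<longrightarrow> (\<exists>g\<in>G. g u = v))"

text \<open>The tuples in \<open>K \<times> \<dots> \<times> K\<close> are identified with the elements of trivial root permutation.\<close>

definition regular_branch_over :: "('x list \<Rightarrow> 'x list) set \<Rightarrow> ('x list \<Rightarrow> 'x list) set \<Rightarrow> bool" where
  "regular_branch_over G K \<longleftrightarrow>
     level_transitive G \<and>
     subgroup K (Aut_tree\<lparr>carrier := G\<rparr>) \<and>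
     finite (rcosets\<^bsub>Aut_tree\<lparr>carrier := G\<rparr>\<^esub> K) \<and>
     (UNIV \<rightarrow> K) \<times> {id} \<subseteq> psi ` (K \<inter> St1)"

definition spinal_hanoi_data :: "('x \<Rightarrow> 'x \<Rightarrow> 'x) \<Rightarrow> bool" where
  "spinal_hanoi_data \<sigma> \<longleftrightarrow> (\<forall>i. bij (\<sigma> i) \<and> \<sigma> i \<noteq> id \<and> \<sigma> i i = i)"

text \<open>
  The generator \<open>a\<^sub>i\<close>; the equation \<open>\<psi>(a\<^sub>i) = (1,\<dots>,1,a\<^sub>i,1,\<dots>,1) \<sigma>\<^sub>i\<close> is lemma
  \<open>psi_hanoi_gen\<close> below.
\<close>

fun hanoi_gen :: "('x \<Rightarrow> 'x \<Rightarrow> 'x) \<Rightarrow> 'x \<Rightarrow> 'x list \<Rightarrow> 'x list" where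
  "hanoi_gen \<sigma> i [] = []"
| "hanoi_gen \<sigma> i (x # w) = \<sigma> i x # (if x = i then hanoi_gen \<sigma> i w else w)"

definition hanoi_group :: "('x \<Rightarrow> 'x \<Rightarrow> 'x) \<Rightarrow> ('x list \<Rightarrow> 'x list) set" where
  "hanoi_group \<sigma> = generate Aut_tree (range (hanoi_gen \<sigma>))"

definition J_group :: "('x list \<Rightarrow> 'x list) set \<Rightarrow> ('x list \<Rightarrow> 'x list) set" where
  "J_group G = generate Aut_tree
     {g \<in> St1. \<exists>h\<in>G. \<exists>p q. p \<noteq> q \<and> psi g = ((\<lambda>_. id)(p := h, q := inv\<^bsub>Aut_tree\<^esub> h), id)}"

text \<open>The group \<open>A\<close>, written multiplicatively, although its operation is addition.\<close>

definition A_group :: "('x \<Rightarrow> 'x \<Rightarrow> 'x) \<Rightarrow> ('x \<Rightarrow> int) monoid" where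
  "A_group \<sigma> = product_group UNIV (\<lambda>i. integer_mod_group (group.ord Aut_tree (hanoi_gen \<sigma> i)))"

text \<open>
  \<open>integer_mod_group n\<close> has carrier \<open>{0..<n}\<close> for \<open>n > 0\<close>, hence the reduction of \<open>1\<close>.
\<close>

definition A_gen :: "('x \<Rightarrow> 'x \<Rightarrow> 'x) \<Rightarrow> 'x \<Rightarrow> ('x \<Rightarrow> int)" where
  "A_gen \<sigma> i = (\<lambda>j. if j = i then 1 mod int (group.ord Aut_tree (hanoi_gen \<sigma> i)) else 0)"

text \<open>
  A homomorphism on \<open>G\<close> is determined by its values on the generators; extensionality
  fixes the irrelevant values outside \<open>G\<close>.
\<close>

definition eps :: "('x \<Rightarrow> 'x \<Rightarrow> 'x) \<Rightarrow> ('x list \<Rightarrow> 'x list) \<Rightarrow> ('x \<Rightarrow> int)" where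
  "eps \<sigma> = (THE e. e \<in> hom (Aut_tree\<lparr>carrier := hanoi_group \<sigma>\<rparr>) (A_group \<sigma>) \<and>
                   e \<in> extensional (hanoi_group \<sigma>) \<and>
                   (\<forall>i. e (hanoi_gen \<sigma> i) = A_gen \<sigma> i))"

text \<open>The map \<open>\<Psi>\<close> into the underlying set of \<open>A\<^sup>d \<rtimes> P\<close>.\<close>

definition Psi ::
  "('x \<Rightarrow> 'x \<Rightarrow> 'x) \<Rightarrow> ('x list \<Rightarrow> 'x list) \<Rightarrow> ('x \<Rightarrow> 'x \<Rightarrow> int) \<times> ('x \<Rightarrow> 'x)" where
  "Psi \<sigma> g = ((\<lambda>x. eps \<sigma> (section_at g [x])), root_perm g)"

text \<open>\<open>D\<close> is the kernel of the sum map; \<open>finprod\<close> is the sum of the coordinates in \<open>A\<close>.\<close>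

definition D_group :: "('x \<Rightarrow> 'x \<Rightarrow> 'x) \<Rightarrow> ('x \<Rightarrow> 'x \<Rightarrow> int) set" where
  "D_group \<sigma> = kernel (product_group UNIV (\<lambda>_. A_group \<sigma>)) (A_group \<sigma>)
                  (\<lambda>v. finprod (A_group \<sigma>) v UNIV)"

lemma hanoi_gen_bij:
  assumes "bij (\<sigma> i)" "\<sigma> i i = i"
  shows "bij (hanoi_gen \<sigma> i)"
proof (rule bijI)
  have eq: "\<sigma> i x = \<sigma> i y \<longleftrightarrow> x = y" for x y
    using assms(1) by (meson bij_is_inj inj_eq)
  show "inj (hanoi_gen \<sigma> i)"
  proof (rule injI)
    fix u v show "hanoi_gen \<sigma> i u = hanoi_gen \<sigma> i v \<Longrightarrow> u = v"
    proof (induction u arbitrary: v)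
      case Nil then show ?case by (cases v) auto
    next
      case (Cons x u) then show ?case by (cases v) (auto simp: eq split: if_splits)
    qed
  qed
  have "\<exists>u. hanoi_gen \<sigma> i u = v" for v
  proof (induction v)
    case Nil show ?case by (rule exI[of _ "[]"]) simp
  next
    case (Cons y v)
    then obtain u where u: "hanoi_gen \<sigma> i u = v" by blast
    obtain x where x: "\<sigma> i x = y" using assms(1) by (metis bij_is_surj surjD)
    show ?case by (rule exI[of _ "x # (if x = i then u else v)"]) (simp add: u x)
  qed
  then show "surj (hanoi_gen \<sigma> i)" by (metis surjI)
qed

lemma hanoi_gen_append_single: "\<exists>y. hanoi_gen \<sigma> i (u @ [x]) = hanoi_gen \<sigma> i u @ [y]"
  by (induction u) auto

lemma tree_automorphismI:
  assumes "bij g" "g [] = []" "\<And>u x. \<exists>y. g (u @ [x]) = g u @ [y]"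
  shows "g \<in> tree_automorphisms"
proof -
  have "child u v" if "child (g u) (g v)" for u v
  proof (cases v rule: rev_cases)
    case Nil then show ?thesis using that assms(2) by (simp add: child_def)
  next
    case (snoc w x)
    obtain y where "g v = g w @ [y]" using assms(3) snoc by blast
    then have "g u = g w" using that by (auto simp: child_def)
    then show ?thesis using assms(1) snoc by (auto simp: child_def dest: bij_is_inj injD)
  qed
  then show ?thesis using assms by (auto simp: tree_automorphisms_def child_def)
qed

lemma hanoi_gen_in_Aut_tree:
  assumes "spinal_hanoi_data \<sigma>"
  shows "hanoi_gen \<sigma> i \<in> carrier Aut_tree"
proof -
  have "hanoi_gen \<sigma> i \<in> tree_automorphisms"
    using assms hanoi_gen_append_single[of \<sigma> i]
    by (intro tree_automorphismI hanoi_gen_bij) (auto simp: spinal_hanoi_data_def)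
  then show ?thesis by (simp add: Aut_tree_def)
qed

lemma psi_hanoi_gen: "psi (hanoi_gen \<sigma> i) = ((\<lambda>_. id)(i := hanoi_gen \<sigma> i), \<sigma> i)"
  by (auto simp: psi_def section_at_def root_perm_def fun_eq_iff)

lemma section_at_append:
  assumes "g \<in> carrier Aut_tree"
  shows "g (v @ w) = g v @ section_at g v w"
proof -
  have ch: "\<exists>y. g (u @ [x]) = g u @ [y]" for u x
    using assms by (auto simp: Aut_tree_def tree_automorphisms_def child_def)
  have "\<exists>w'. g (v @ w) = g v @ w'"
  proof (induction w rule: rev_induct)
    case Nil then show ?case by simp
  next
    case (snoc x w)
    then show ?case using ch[of "v @ w" x] by auto
  qed
  then show ?thesis by (auto simp: section_at_def)
qed

lemma group_Aut_tree: "group Aut_tree"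
proof (rule groupI)
  fix g :: "'a list \<Rightarrow> 'a list" assume "g \<in> carrier Aut_tree"
  then have g: "bij g" "g [] = []" "\<And>u v. child (g u) (g v) \<longleftrightarrow> child u v"
    by (auto simp: Aut_tree_def tree_automorphisms_def)
  have r: "g (inv_into UNIV g u) = u" for u using g(1) by (simp add: bij_is_surj surj_f_inv_f)
  have l: "inv_into UNIV g (g u) = u" for u using g(1) by (simp add: bij_is_inj)
  have "inv_into UNIV g \<in> tree_automorphisms"
    using g(1,2) l[of "[]"] g(3)[of "inv_into UNIV g u" "inv_into UNIV g v" for u v]
    by (auto simp: tree_automorphisms_def bij_imp_bij_inv r)
  then show "\<exists>h\<in>carrier Aut_tree. h \<otimes>\<^bsub>Aut_tree\<^esub> g = \<one>\<^bsub>Aut_tree\<^esub>"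
    by (intro bexI[of _ "inv_into UNIV g"]) (auto simp: Aut_tree_def r fun_eq_iff)
qed (auto simp: Aut_tree_def tree_automorphisms_def bij_comp comp_assoc)

end

theory Submission
  imports Defs
begin

text \<open>
  The generators of \<open>J\<close> are the tuples \<open>(1,\<dots>,h,\<dots>,h\<^sup>-\<^sup>1,\<dots>,1)\<close> with \<open>h \<in> G\<close>; they are called
  antidiagonal here, and \<open>J \<le> G\<close> says that \<open>G\<close> contains all of them
  (\<open>J_group_subset_iff\<close>).

  Suppose that \<open>G\<close> contains them. Two antidiagonal elements that share only the coordinate \<open>p\<close>,
  with entries \<open>h\<close> and \<open>k\<close> there, have the commutator \<open>[h,k]\<close> at \<open>p\<close> and nothing elsewhere.
  Such a pair exists because \<open>\<sigma>\<^sub>p\<close> fixes \<open>p\<close> and moves something, so that there are at least three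
  letters. Hence \<open>G'\<close> contains every copy of itself in one coordinate (\<open>single_in_G'\<close>),
  and therefore the product of these copies (\<open>tuple_in_G'\<close>). The images of the antidiagonal
  elements under \<open>\<Psi>\<close> are the tuples with entries \<open>u\<close> and \<open>-u\<close> in two coordinates, and these
  generate \<open>D\<close> (\<open>antidiagonals_imp_D\<close>).

  Conversely, the image under \<open>\<Psi>\<close> of an antidiagonal element lies in \<open>D\<close>, so it is also the image
  of some \<open>g \<in> St\<^sub>G(1)\<close>. The sections of the two elements then differ by elements of
  \<open>ker \<epsilon> = G'\<close>, and the branching condition puts this difference into \<open>\<psi>(G')\<close>
  (\<open>D_imp_antidiagonals\<close>).

  Both directions rest on the description of the abelianization, that is, on the existence of
  \<open>\<epsilon>\<close> and on \<open>ker \<epsilon> \<subseteq> G'\<close>. As the \<open>a\<^sub>i\<close> have finite order, the elements of \<open>G\<close> are the values of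
  positive words, and \<open>\<epsilon>\<close> has to count the occurrences of each generator. The point is that in a
  word with value \<open>1\<close> the generator \<open>a\<^sub>i\<close> occurs a multiple of \<open>o(a\<^sub>i)\<close> times
  (\<open>ord_dvd_count_if_relation\<close>). The letters of a word are distributed among the words of its
  first level sections, each letter going to exactly one of them, and the sections of \<open>1\<close> are
  \<open>1\<close>. This allows an induction on length, unless a single section receives all letters; but
  then the word is a power of one generator.
\<close>

section \<open>Tuples of tree automorphisms\<close>

lemma mult_Aut_tree [simp]: "g \<otimes>\<^bsub>Aut_tree\<^esub> h = h \<circ> g"
  by (simp add: Aut_tree_def)

lemma one_Aut_tree [simp]: "\<one>\<^bsub>Aut_tree\<^esub> = id"
  by (simp add: Aut_tree_def)

lemma id_in_Aut_tree: "id \<in> carrier Aut_tree"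
  using group.is_monoid[OF group_Aut_tree] monoid.one_closed by force

lemma Aut_tree_append_single:
  assumes "g \<in> carrier Aut_tree"
  shows "\<exists>y. g (u @ [x]) = g u @ [y]"
  using assms by (auto simp: Aut_tree_def tree_automorphisms_def child_def)

text \<open>
  The inverse of \<open>\<psi>\<close> on the stabilizer of the first level: \<open>tuple k\<close> is the element with sections
  \<open>k\<close> and trivial root permutation.
\<close>

fun tuple :: "('x \<Rightarrow> 'x list \<Rightarrow> 'x list) \<Rightarrow> 'x list \<Rightarrow> 'x list" where
  "tuple k [] = []"
| "tuple k (x # w) = x # k x w"

text \<open>
  Composition is written from right to left, so \<open>l x \<circ> k x\<close> is the product of \<open>k x\<close> and \<open>l x\<close> in
  \<^const>\<open>Aut_tree\<close>.
\<close>

lemma tuple_comp: "tuple l \<circ> tuple k = tuple (\<lambda>x. l x \<circ> k x)"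
proof
  fix w show "(tuple l \<circ> tuple k) w = tuple (\<lambda>x. l x \<circ> k x) w" by (cases w) auto
qed

lemma tuple_id: "tuple (\<lambda>_. id) = id"
proof
  fix w :: "'a list" show "tuple (\<lambda>_. id) w = id w" by (cases w) auto
qed

lemma tuple_in_Aut_tree:
  assumes "\<And>x. k x \<in> carrier Aut_tree"
  shows "tuple k \<in> carrier Aut_tree"
proof -
  have k: "bij (k x)" "k x [] = []" for x
    using assms[of x] by (auto simp: Aut_tree_def tree_automorphisms_def)
  have "tuple (\<lambda>x. inv_into UNIV (k x)) \<circ> tuple k = id"
    "tuple k \<circ> tuple (\<lambda>x. inv_into UNIV (k x)) = id"
    using k(1) by (simp_all add: tuple_comp tuple_id bij_is_inj surj_iff[THEN iffD1] bij_is_surj)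
  then have "bij (tuple k)" by (rule o_bij)
  moreover have "\<exists>y. tuple k (u @ [x]) = tuple k u @ [y]" for u x
    using Aut_tree_append_single[OF assms] k(2) by (cases u) auto
  ultimately show ?thesis
    using tree_automorphismI[of "tuple k"] by (auto simp: Aut_tree_def)
qed

lemma inv_tuple:
  assumes "\<And>x. k x \<in> carrier Aut_tree"
  shows "inv\<^bsub>Aut_tree\<^esub> tuple k = tuple (\<lambda>x. inv\<^bsub>Aut_tree\<^esub> (k x))"
proof -
  interpret group "Aut_tree :: ('a list \<Rightarrow> 'a list) monoid" by (rule group_Aut_tree)
  have "k x \<circ> inv\<^bsub>Aut_tree\<^esub> (k x) = id" for x
    using l_inv[OF assms[of x]] by simp
  then show ?thesis
    using assms by (intro inv_equality) (simp_all add: tuple_comp tuple_id tuple_in_Aut_tree)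
qed

lemma Aut_tree_Nil: "g \<in> carrier Aut_tree \<Longrightarrow> g [] = []"
  by (auto simp: Aut_tree_def tree_automorphisms_def)

lemma psi_tuple:
  assumes "\<And>x. k x \<in> carrier Aut_tree"
  shows "psi (tuple k) = (k, id)"
  using Aut_tree_Nil[OF assms] by (auto simp: psi_def section_at_def root_perm_def fun_eq_iff)

lemma tuple_in_St1:
  assumes "\<And>x. k x \<in> carrier Aut_tree"
  shows "tuple k \<in> St1"
proof -
  have "k x [] = []" for x
    using assms[of x] by (auto simp: Aut_tree_def tree_automorphisms_def)
  then show ?thesis using tuple_in_Aut_tree[OF assms] by (simp add: St1_def)
qed

lemma St1_eq_tuple:
  assumes "g \<in> St1"
  shows "g = tuple (\<lambda>x. section_at g [x])"
proof
  fix w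
  have g: "g \<in> carrier Aut_tree" and fix1: "\<And>x. g [x] = [x]" using assms by (auto simp: St1_def)
  have "g [] = []" using g by (auto simp: Aut_tree_def tree_automorphisms_def)
  then show "g w = tuple (\<lambda>x. section_at g [x]) w"
    using section_at_append[OF g, of "[x]" for x] fix1 by (cases w) auto
qed

lemma St1_eq_tupleI:
  assumes "g \<in> St1" "psi g = (k, id)"
  shows "g = tuple k"
  using St1_eq_tuple[OF assms(1)] assms(2) by (simp add: psi_def)


section \<open>Words in the generators\<close>

text \<open>
  A word \<open>[i\<^sub>1, \<dots>, i\<^sub>n]\<close> stands for the product of \<open>a\<^sub>i\<close> over its letters from left to right, which
  as a function is \<open>fold (hanoi_gen \<sigma>)\<close>. While the product acts on \<open>x # u\<close>, the first letter
  runs through the orbit of \<open>x\<close> under the successive \<open>\<sigma>\<^sub>i\<close>, and \<open>a\<^sub>i\<close> acts on \<open>u\<close> only if that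
  letter is currently \<open>i\<close>. The word \<open>section_word \<sigma> w x\<close> records the generators that do.
\<close>

fun section_word :: "('x \<Rightarrow> 'x \<Rightarrow> 'x) \<Rightarrow> 'x list \<Rightarrow> 'x \<Rightarrow> 'x list" where
  "section_word \<sigma> [] x = []"
| "section_word \<sigma> (i # w) x =
     (if x = i then i # section_word \<sigma> w (\<sigma> i x) else section_word \<sigma> w (\<sigma> i x))"

lemma fold_hanoi_gen_Cons:
  "fold (hanoi_gen \<sigma>) w (x # u) = fold \<sigma> w x # fold (hanoi_gen \<sigma>) (section_word \<sigma> w x) u"
  by (induction w arbitrary: x u) auto

lemma fold_hanoi_gen_Nil: "fold (hanoi_gen \<sigma>) w [] = []"
  by (induction w) auto

lemma section_at_fold_hanoi_gen:
  "section_at (fold (hanoi_gen \<sigma>) w) [x] = fold (hanoi_gen \<sigma>) (section_word \<sigma> w x)"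
  by (auto simp: section_at_def fold_hanoi_gen_Cons fold_hanoi_gen_Nil)

lemma length_section_word_le: "length (section_word \<sigma> w x) \<le> length w"
  by (induction w arbitrary: x) (auto intro: le_SucI)

text \<open>
  If no letter is lost in the section at \<open>x\<close>, the first one is \<open>x\<close>. Since \<open>\<sigma>\<^sub>x\<close> fixes \<open>x\<close>, the
  current letter is still \<open>x\<close> afterwards, and so on.
\<close>

lemma length_section_word_eqD:
  assumes "\<And>i. \<sigma> i i = i" "length (section_word \<sigma> w x) = length w"
  shows "w = replicate (length w) x"
  using assms(2)
proof (induction w)
  case (Cons i w)
  have "x = i"
    using Cons.prems length_section_word_le[of \<sigma> w "\<sigma> i x"] by (auto split: if_splits)
  then show ?case using Cons assms(1) by simp
qed simp

text \<open>
  Each position of \<open>w\<close> contributes to exactly one section word, because the permutations applied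
  before it send exactly one initial letter to the letter found there.
\<close>

lemma sum_count_section_word:
  fixes \<sigma> :: "'x::finite \<Rightarrow> 'x \<Rightarrow> 'x"
  assumes "\<And>i. bij (\<sigma> i)"
  shows "(\<Sum>x\<in>UNIV. count_list (section_word \<sigma> w x) i) = count_list w i"
proof (induction w)
  case (Cons j w)
  have "(\<Sum>x\<in>UNIV. count_list (section_word \<sigma> (j # w) x) i) =
        (\<Sum>x\<in>UNIV. (if x = j then if j = i then 1 else 0 else 0) + count_list (section_word \<sigma> w (\<sigma> j x)) i)"
    by (intro sum.cong) auto
  also have "\<dots> = (if j = i then 1 else 0) + (\<Sum>x\<in>UNIV. count_list (section_word \<sigma> w (\<sigma> j x)) i)"
    by (simp add: sum.distrib)
  also have "(\<Sum>x\<in>UNIV. count_list (section_word \<sigma> w (\<sigma> j x)) i) =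
             (\<Sum>x\<in>UNIV. count_list (section_word \<sigma> w x) i)"
    by (rule sum.reindex_bij_betw) (use assms in auto)
  finally show ?case using Cons by simp
qed simp

text \<open>
  The fixed point \<open>i\<close> of \<open>\<sigma>\<^sub>i\<close> is on no other orbit. So in a power of \<open>a\<^sub>i\<close> nothing accumulates at
  the other coordinates, and the order of \<open>a\<^sub>i\<close> is that of \<open>\<sigma>\<^sub>i\<close>.
\<close>

lemma funpow_hanoi_gen_Cons:
  assumes "bij (\<sigma> i)" "\<sigma> i i = i"
  shows "(hanoi_gen \<sigma> i ^^ n) (x # w) =
         (\<sigma> i ^^ n) x # (if x = i then (hanoi_gen \<sigma> i ^^ n) w else w)"
proof -
  have "(\<sigma> i ^^ n) x = i \<longleftrightarrow> x = i" for n
  proof -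
    have fix_i: "(\<sigma> i ^^ n) i = i" by (induction n) (auto simp: assms(2))
    have "inj (\<sigma> i ^^ n)" using assms(1) by (simp add: bij_is_inj inj_fn)
    then show ?thesis using fix_i by (metis injD)
  qed
  then show ?thesis by (induction n) auto
qed

lemma hanoi_gen_finite_order:
  fixes \<sigma> :: "'x::finite \<Rightarrow> 'x \<Rightarrow> 'x"
  assumes "bij (\<sigma> i)" "\<sigma> i i = i"
  obtains n where "n > 0" "hanoi_gen \<sigma> i ^^ n = id"
proof -
  obtain n where n: "n > 0" "\<sigma> i ^^ n = id"
    using permutation_is_nilpotent[of "\<sigma> i"] assms(1) by (auto simp: permutation)
  have "(hanoi_gen \<sigma> i ^^ n) [] = []" by (induction n) auto
  then have "(hanoi_gen \<sigma> i ^^ n) w = w" for w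
    by (induction w) (auto simp: funpow_hanoi_gen_Cons[of \<sigma> i, OF assms] n)
  with n(1) that show ?thesis by (auto simp: fun_eq_iff)
qed


section \<open>The group and its abelianization\<close>

locale spinal_hanoi =
  fixes \<sigma> :: "'x::finite \<Rightarrow> 'x \<Rightarrow> 'x"
  assumes data: "spinal_hanoi_data \<sigma>"
begin

abbreviation a where "a \<equiv> hanoi_gen \<sigma>"
abbreviation G where "G \<equiv> hanoi_group \<sigma>"
abbreviation o\<^sub>a where "o\<^sub>a i \<equiv> group.ord Aut_tree (a i)"
abbreviation G_monoid where "G_monoid \<equiv> Aut_tree\<lparr>carrier := G\<rparr>"

lemma bij_sigma: "bij (\<sigma> i)" and sigma_fix: "\<sigma> i i = i" and sigma_neq_id: "\<sigma> i \<noteq> id"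
  using data by (auto simp: spinal_hanoi_data_def)

sublocale aut: group "Aut_tree :: ('x list \<Rightarrow> 'x list) monoid"
  by (rule group_Aut_tree)

lemma subgroup_G: "subgroup G Aut_tree"
  unfolding hanoi_group_def
  by (rule aut.generate_is_subgroup) (use hanoi_gen_in_Aut_tree[OF data] in auto)

sublocale G: group G_monoid
  by (rule aut.subgroup_imp_group[OF subgroup_G])

lemma a_in_G: "a i \<in> G"
  by (auto simp: hanoi_group_def intro: generate.incl)

lemma G_subset: "g \<in> G \<Longrightarrow> g \<in> carrier Aut_tree"
  using subgroup.mem_carrier[OF subgroup_G] .

lemma G_comp: "g \<in> G \<Longrightarrow> h \<in> G \<Longrightarrow> h \<circ> g \<in> G"
  using subgroup.m_closed[OF subgroup_G, of g h] by simp

lemma G_id: "id \<in> G"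
  using subgroup.one_closed[OF subgroup_G] by simp

lemma G_inv: "g \<in> G \<Longrightarrow> inv\<^bsub>Aut_tree\<^esub> g \<in> G"
  using subgroup.m_inv_closed[OF subgroup_G] .

lemma fold_a_in_G: "fold a w \<in> G"
proof (induction w)
  case Nil show ?case using G_id by (simp add: id_def)
next
  case (Cons i w) then show ?case using G_comp[OF a_in_G[of i]] by (simp add: comp_def)
qed

lemma pow_Aut_tree: "g [^]\<^bsub>Aut_tree\<^esub> (n::nat) = g ^^ n" for g :: "'x list \<Rightarrow> 'x list"
proof (induction n)
  case (Suc n) then show ?case by simp
qed simp

lemma fold_replicate: "fold a (replicate n i) = a i ^^ n"
  by (induction n) (auto simp: funpow_Suc_right simp del: funpow.simps(2))

text \<open>
  As \<open>a\<^sub>i\<close> has finite order, its inverse is a positive power, and positive words suffice.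
\<close>

lemma ex_inverse_word: "\<exists>v. fold a (w @ v) = id"
proof (induction w)
  case Nil show ?case by (rule exI[of _ "[]"]) (simp add: id_def)
next
  case (Cons i w)
  then obtain v where v: "fold a (w @ v) = id" by blast
  obtain n where n: "n > 0" "a i ^^ n = id"
    using hanoi_gen_finite_order[of \<sigma> i] bij_sigma sigma_fix by metis
  have "fold a ((i # w) @ (v @ replicate (n - 1) i)) = (a i ^^ (n - 1)) \<circ> fold a (w @ v) \<circ> a i"
    by (simp add: fold_replicate comp_assoc)
  also have "\<dots> = a i ^^ n"
    using n(1) v by (cases n) (auto simp: funpow_Suc_right simp del: funpow.simps(2))
  finally show ?case using n(2) by metis
qed

lemma G_eq_words: "G = range (fold a)"
proof -
  have "g \<in> range (fold a)" if "g \<in> generate Aut_tree (range a)" for g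
    using that
  proof induction
    case one then show ?case by (auto intro: image_eqI[of _ _ "[]"] simp: id_def)
  next
    case (incl h)
    then obtain i where "h = fold a [i]" by auto
    then show ?case by blast
  next
    case (inv h)
    then obtain i where i: "h = a i" by auto
    obtain v where v: "fold a ([i] @ v) = id" using ex_inverse_word by blast
    have hG: "h \<in> carrier Aut_tree" "fold a v \<in> carrier Aut_tree"
      using i a_in_G fold_a_in_G G_subset by auto
    have "h \<otimes>\<^bsub>Aut_tree\<^esub> fold a v = \<one>\<^bsub>Aut_tree\<^esub>" using v i by simp
    then have "inv\<^bsub>Aut_tree\<^esub> h = fold a v"
      using hG aut.inv_equality aut.inv_comm by metis
    then show ?case by blast
  next
    case (eng g h)
    then obtain u v where "g = fold a u" "h = fold a v" by auto
    then have "g \<otimes>\<^bsub>Aut_tree\<^esub> h = fold a (u @ v)" by simp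
    then show ?case by blast
  qed
  then show ?thesis using fold_a_in_G by (auto simp: hanoi_group_def)
qed

lemma section_in_G: "g \<in> G \<Longrightarrow> section_at g [x] \<in> G"
  by (auto simp: G_eq_words section_at_fold_hanoi_gen)

lemma count_list_replicate: "count_list (replicate n j) i = (if i = j then n else 0)"
  by (induction n) auto

text \<open>
  The section words of a relation are relations, and their letter counts add up to that of the
  word. If all of them are shorter, induction applies. If one is not, the word is a power
  \<open>a\<^sub>x\<^sup>n\<close>, and \<open>a\<^sub>x\<^sup>n = 1\<close> means that the order of \<open>a\<^sub>x\<close> divides \<open>n\<close>.
\<close>

lemma ord_dvd_count_if_relation:
  assumes "fold a w = id"
  shows "o\<^sub>a i dvd count_list w i"
  using assms
proof (induction "length w" arbitrary: w rule: less_induct)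
  case less
  have sec: "fold a (section_word \<sigma> w x) = id" for x
    using fold_hanoi_gen_Cons[of \<sigma> w x] less.prems by (auto simp: fun_eq_iff)
  show ?case
  proof (cases "\<exists>x. length (section_word \<sigma> w x) = length w")
    case True
    then obtain x where x: "w = replicate (length w) x"
      using length_section_word_eqD sigma_fix by metis
    have "a x ^^ length w = id" using less.prems x fold_replicate by metis
    then have "o\<^sub>a x dvd length w"
      using aut.pow_eq_id[OF G_subset[OF a_in_G]] by (simp add: pow_Aut_tree)
    moreover have "count_list w i = (if i = x then length w else 0)"
      by (subst x) (simp add: count_list_replicate)
    ultimately show ?thesis by simp
  next
    case False
    then have "length (section_word \<sigma> w x) < length w" for x
      using length_section_word_le[of \<sigma> w x] by (simp add: le_neq_implies_less)
    then have "o\<^sub>a i dvd count_list (section_word \<sigma> w x) i" for x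
      using less.hyps sec by blast
    then have "o\<^sub>a i dvd (\<Sum>x\<in>UNIV. count_list (section_word \<sigma> w x) i)"
      by (intro dvd_sum) auto
    then show ?thesis by (simp add: sum_count_section_word bij_sigma)
  qed
qed

text \<open>The value that \<open>\<epsilon>\<close> must take on the product of a word.\<close>

definition exponents :: "'x list \<Rightarrow> 'x \<Rightarrow> int" where
  "exponents w = (\<lambda>i. int (count_list w i) mod int (o\<^sub>a i))"

text \<open>
  Two words with the same value become relations when the same inverse word is appended.
\<close>

lemma exponents_well_defined:
  assumes "fold a u = fold a w"
  shows "exponents u = exponents w"
proof
  fix i
  obtain v where v: "fold a (w @ v) = id" using ex_inverse_word by blast
  then have "fold a (u @ v) = id" using assms by simp
  then have "o\<^sub>a i dvd count_list (u @ v) i" "o\<^sub>a i dvd count_list (w @ v) i"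
    using v ord_dvd_count_if_relation by blast+
  then have "int (o\<^sub>a i) dvd (int (count_list (u @ v) i) - int (count_list (w @ v) i))"
    by (meson dvd_diff of_nat_dvd_iff)
  then show "exponents u i = exponents w i"
    by (simp add: exponents_def mod_eq_dvd_iff)
qed

lemma comm_group_A: "comm_group (A_group \<sigma>)"
proof -
  interpret A: group "A_group \<sigma>" unfolding A_group_def by (rule product_group) simp
  show ?thesis
    by (rule A.group_comm_groupI) (auto simp: A_group_def add.commute)
qed

sublocale A: comm_group "A_group \<sigma>"
  by (rule comm_group_A)

lemma A_mult: "u \<otimes>\<^bsub>A_group \<sigma>\<^esub> v = (\<lambda>i. (u i + v i) mod int (o\<^sub>a i))"
  by (simp add: A_group_def restrict_UNIV)

lemma A_one: "\<one>\<^bsub>A_group \<sigma>\<^esub> = (\<lambda>_. 0)"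
  by (simp add: A_group_def restrict_UNIV)

lemma ord_a_pos: "o\<^sub>a i > 0"
proof -
  obtain n where n: "n > 0" "a i ^^ n = id"
    using hanoi_gen_finite_order[of \<sigma> i] bij_sigma sigma_fix by metis
  then have "o\<^sub>a i dvd n"
    using aut.pow_eq_id[OF G_subset[OF a_in_G]] by (simp add: pow_Aut_tree)
  then show ?thesis using n(1) by (auto intro: Nat.gr0I)
qed

lemma A_carrier: "carrier (A_group \<sigma>) = (\<Pi> i\<in>UNIV. {0..<int (o\<^sub>a i)})"
proof -
  have "carrier (integer_mod_group (o\<^sub>a i)) = {0..<int (o\<^sub>a i)}" for i
    using ord_a_pos[of i] by (simp add: carrier_integer_mod_group)
  then show ?thesis by (simp add: A_group_def PiE_UNIV_domain)
qed

lemma exponents_append: "exponents (u @ v) = exponents u \<otimes>\<^bsub>A_group \<sigma>\<^esub> exponents v"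
  by (simp add: A_mult exponents_def mod_simps)

text \<open>
  The function sending the value of \<open>w\<close> to \<open>exponents w\<close> is a homomorphism with the prescribed
  values on the generators; as positive words exhaust \<open>G\<close>, it is the only one.
\<close>

lemma eps_fold: "eps \<sigma> (fold a w) = exponents w"
  and eps_hom: "eps \<sigma> \<in> hom G_monoid (A_group \<sigma>)"
proof -
  define e where "e = restrict (\<lambda>g. exponents (SOME w. fold a w = g)) G"
  have e_fold: "e (fold a w) = exponents w" for w
  proof -
    have "fold a (SOME u. fold a u = fold a w) = fold a w" by (rule someI) simp
    from exponents_well_defined[OF this] show ?thesis by (simp add: e_def fold_a_in_G)
  qed
  have e_hom: "e \<in> hom G_monoid (A_group \<sigma>)"
  proof (rule homI)
    fix g assume "g \<in> carrier G_monoid"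
    then show "e g \<in> carrier (A_group \<sigma>)"
      using ord_a_pos by (auto simp: G_eq_words e_fold A_carrier exponents_def)
  next
    fix g h assume "g \<in> carrier G_monoid" "h \<in> carrier G_monoid"
    then obtain u v where uv: "g = fold a u" "h = fold a v" by (auto simp: G_eq_words)
    have "e (g \<otimes>\<^bsub>G_monoid\<^esub> h) = e (fold a (u @ v))" by (simp add: uv)
    then show "e (g \<otimes>\<^bsub>G_monoid\<^esub> h) = e g \<otimes>\<^bsub>A_group \<sigma>\<^esub> e h"
      unfolding e_fold uv exponents_append .
  qed
  have "eps \<sigma> = e"
    unfolding eps_def
  proof (rule the_equality)
    show "e \<in> hom G_monoid (A_group \<sigma>) \<and> e \<in> extensional G \<and> (\<forall>i. e (a i) = A_gen \<sigma> i)"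
    proof (intro conjI allI)
      fix i
      show "e (a i) = A_gen \<sigma> i"
        using e_fold[of "[i]"] by (auto simp: exponents_def A_gen_def)
    qed (use e_hom in \<open>auto simp: e_def\<close>)
  next
    fix f assume f: "f \<in> hom G_monoid (A_group \<sigma>) \<and> f \<in> extensional G \<and> (\<forall>i. f (a i) = A_gen \<sigma> i)"
    interpret f: group_hom G_monoid "A_group \<sigma>" f
      using f by unfold_locales auto
    have f_fold: "f (fold a w) = exponents w" for w
    proof (induction w)
      case Nil
      have "f id = \<one>\<^bsub>A_group \<sigma>\<^esub>" using f.hom_one by simp
      then show ?case by (simp add: id_def A_one exponents_def)
    next
      case (Cons i w)
      have "f (fold a (i # w)) = f (a i) \<otimes>\<^bsub>A_group \<sigma>\<^esub> f (fold a w)"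
        using f.hom_mult[of "a i" "fold a w"] a_in_G fold_a_in_G by simp
      also have "f (a i) = exponents [i]"
        using f by (auto simp: exponents_def A_gen_def)
      finally show ?case using exponents_append[of "[i]" w] Cons by simp
    qed
    show "f = e"
    proof (rule extensionalityI[of _ G])
      show "f \<in> extensional G" "e \<in> extensional G" using f by (auto simp: e_def)
      show "f g = e g" if "g \<in> G" for g using that by (auto simp: G_eq_words f_fold e_fold)
    qed
  qed
  then show "eps \<sigma> (fold a w) = exponents w" "eps \<sigma> \<in> hom G_monoid (A_group \<sigma>)"
    using e_fold e_hom by auto
qed

sublocale eps: group_hom G_monoid "A_group \<sigma>" "eps \<sigma>"
  by unfold_locales (rule eps_hom)

lemma eps_closed: "g \<in> G \<Longrightarrow> eps \<sigma> g \<in> carrier (A_group \<sigma>)"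
  using eps.hom_closed by simp

lemma eps_comp: "g \<in> G \<Longrightarrow> h \<in> G \<Longrightarrow> eps \<sigma> (h \<circ> g) = eps \<sigma> g \<otimes>\<^bsub>A_group \<sigma>\<^esub> eps \<sigma> h"
  using eps.hom_mult[of g h] by simp

lemma eps_id: "eps \<sigma> id = \<one>\<^bsub>A_group \<sigma>\<^esub>"
  using eps.hom_one by simp

lemma inv_G_monoid: "g \<in> G \<Longrightarrow> inv\<^bsub>G_monoid\<^esub> g = inv\<^bsub>Aut_tree\<^esub> g"
  using aut.m_inv_consistent[OF subgroup_G] .

lemma eps_inv: "g \<in> G \<Longrightarrow> eps \<sigma> (inv\<^bsub>Aut_tree\<^esub> g) = inv\<^bsub>A_group \<sigma>\<^esub> eps \<sigma> g"
  using eps.hom_inv[of g] inv_G_monoid by simp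

lemma eps_surj:
  assumes "v \<in> carrier (A_group \<sigma>)"
  obtains g where "g \<in> G" "eps \<sigma> g = v"
proof -
  have "\<exists>w. \<forall>i. count_list w i = (if i \<in> S then nat (v i) else 0)" if "finite S" for S
    using that
  proof (induction S)
    case empty show ?case by (rule exI[of _ "[]"]) simp
  next
    case (insert j S)
    then obtain w where w: "\<forall>i. count_list w i = (if i \<in> S then nat (v i) else 0)" by blast
    have "\<forall>i. count_list (replicate (nat (v j)) j @ w) i = (if i \<in> insert j S then nat (v i) else 0)"
      using w insert.hyps by (auto simp: count_list_replicate)
    then show ?case by blast
  qed
  from this[of UNIV] obtain w where w: "\<And>i. count_list w i = nat (v i)" by auto
  have "exponents w i = v i" for i
  proof -
    have "v i \<in> {0..<int (o\<^sub>a i)}" using assms by (auto simp: A_carrier)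
    then show ?thesis by (simp add: exponents_def w)
  qed
  then have "eps \<sigma> (fold a w) = v" by (auto simp: eps_fold)
  with fold_a_in_G that show ?thesis by blast
qed

abbreviation G' where "G' \<equiv> derived Aut_tree G"

lemma G'_eq: "derived G_monoid (carrier G_monoid) = G'"
  using aut.derived_consistent[OF _ subgroup_G, of G] by simp

lemma normal_G': "G' \<lhd> G_monoid"
  using aut.derived_subgroup_is_normal[OF subgroup_G] .

lemma subgroup_G': "subgroup G' Aut_tree"
  by (rule aut.derived_is_subgroup) (use G_subset in auto)

lemma G'_subset_G: "G' \<subseteq> G"
  by (rule aut.derived_incl) (use subgroup_G in auto)

lemma hom_fold_comm_group:
  assumes "comm_group H" "f \<in> hom G_monoid H"
  shows "f (fold a w) = finprod H (\<lambda>i. f (a i) [^]\<^bsub>H\<^esub> count_list w i) UNIV"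
proof -
  interpret H: comm_group H by (rule assms(1))
  interpret f: group_hom G_monoid H f
    using assms(2) by unfold_locales auto
  have fa: "f (a i) \<in> carrier H" for i using f.hom_closed a_in_G by simp
  show ?thesis
  proof (induction w)
    case Nil
    then show ?case using f.hom_one by (simp add: id_def)
  next
    case (Cons j w)
    have "f (fold a (j # w)) = f (a j) \<otimes>\<^bsub>H\<^esub> f (fold a w)"
      using f.hom_mult[of "a j" "fold a w"] a_in_G fold_a_in_G by simp
    also have "\<dots> = finprod H (\<lambda>i. if j = i then f (a i) else \<one>\<^bsub>H\<^esub>) UNIV \<otimes>\<^bsub>H\<^esub>
        finprod H (\<lambda>i. f (a i) [^]\<^bsub>H\<^esub> count_list w i) UNIV"
      using H.finprod_singleton[of j UNIV "\<lambda>i. f (a i)"] fa Cons by simp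
    also have "\<dots> = finprod H (\<lambda>i. (if j = i then f (a i) else \<one>\<^bsub>H\<^esub>) \<otimes>\<^bsub>H\<^esub>
        (f (a i) [^]\<^bsub>H\<^esub> count_list w i)) UNIV"
      using fa by (subst H.finprod_multf) auto
    also have "\<dots> = finprod H (\<lambda>i. f (a i) [^]\<^bsub>H\<^esub> count_list (j # w) i) UNIV"
      using fa by (intro H.finprod_cong') (auto simp: H.nat_pow_Suc2[OF fa, symmetric] simp del: H.nat_pow_Suc)
    finally show ?case .
  qed
qed

text \<open>
  In the abelian group \<open>G/G'\<close> the class of a word is the product of the \<open>a\<^sub>i\<close>, each raised to its
  number of occurrences. If these numbers are multiples of the orders, all factors are trivial.
\<close>

lemma eps_trivial_imp_G':
  assumes "g \<in> G" "eps \<sigma> g = \<one>\<^bsub>A_group \<sigma>\<^esub>"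
  shows "g \<in> G'"
proof -
  interpret N: normal G' G_monoid by (rule normal_G')
  interpret Q: comm_group "G_monoid Mod G'"
    using G.derived_quot_is_comm_group by (simp only: G'_eq)
  interpret q: group_hom G_monoid "G_monoid Mod G'" "\<lambda>g. G' #>\<^bsub>G_monoid\<^esub> g"
    using N.r_coset_hom_Mod by unfold_locales auto
  obtain w where w: "g = fold a w" using assms(1) by (auto simp: G_eq_words)
  have "o\<^sub>a i dvd count_list w i" for i
    using assms(2) by (auto simp: w eps_fold exponents_def A_one fun_eq_iff simp flip: zmod_int)
  then have "a i [^]\<^bsub>Aut_tree\<^esub> count_list w i = \<one>\<^bsub>Aut_tree\<^esub>" for i
    using aut.pow_eq_id[OF G_subset[OF a_in_G]] by blast
  then have "a i [^]\<^bsub>G_monoid\<^esub> count_list w i = \<one>\<^bsub>G_monoid\<^esub>" for i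
    using aut.nat_pow_consistent[of "a i" "count_list w i" G] by simp
  then have "(G' #>\<^bsub>G_monoid\<^esub> a i) [^]\<^bsub>G_monoid Mod G'\<^esub> count_list w i = \<one>\<^bsub>G_monoid Mod G'\<^esub>" for i
    using q.hom_nat_pow[of "a i" "count_list w i"] q.hom_one a_in_G by simp
  then have "G' #>\<^bsub>G_monoid\<^esub> g = \<one>\<^bsub>G_monoid Mod G'\<^esub>"
    unfolding w hom_fold_comm_group[OF Q.comm_group_axioms q.homh, of w]
    by (intro Q.finprod_one_eqI)
  then show ?thesis
    using G.coset_join1[OF _ _ N.subgroup_axioms] assms(1) G'_subset_G by (simp add: FactGroup_def)
qed

text \<open>
  Elements with the same image in the finite group \<open>A\<close> lie in the same coset of \<open>G'\<close>.
\<close>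

lemma finite_rcosets_G': "finite (rcosets\<^bsub>G_monoid\<^esub> G')"
proof -
  have coset_eq: "G' #>\<^bsub>G_monoid\<^esub> g = G' #>\<^bsub>G_monoid\<^esub> h"
    if "g \<in> G" "h \<in> G" "eps \<sigma> g = eps \<sigma> h" for g h
  proof -
    have "eps \<sigma> (g \<otimes>\<^bsub>G_monoid\<^esub> inv\<^bsub>G_monoid\<^esub> h) = \<one>\<^bsub>A_group \<sigma>\<^esub>"
      using that eps_closed[of h] eps_comp[of g "inv\<^bsub>Aut_tree\<^esub> h"] G_inv[of h]
      by (simp add: inv_G_monoid eps_inv)
    then have "g \<otimes>\<^bsub>G_monoid\<^esub> inv\<^bsub>G_monoid\<^esub> h \<in> G'"
      using that G_comp[of g "inv\<^bsub>Aut_tree\<^esub> h"] G_inv[of h]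
      by (intro eps_trivial_imp_G') (auto simp: inv_G_monoid)
    then have "G' #>\<^bsub>G_monoid\<^esub> (g \<otimes>\<^bsub>G_monoid\<^esub> inv\<^bsub>G_monoid\<^esub> h) = G'"
      using G'_subset_G by (intro G.coset_join2 normal_imp_subgroup[OF normal_G']) auto
    then show ?thesis
      using that G'_subset_G by (intro G.coset_mult_inv1) auto
  qed
  have "finite (carrier (A_group \<sigma>))"
    unfolding A_carrier PiE_UNIV_domain[symmetric] by (intro finite_PiE) auto
  moreover have "rcosets\<^bsub>G_monoid\<^esub> G' \<subseteq>
      (\<lambda>v. G' #>\<^bsub>G_monoid\<^esub> (SOME g. g \<in> G \<and> eps \<sigma> g = v)) ` carrier (A_group \<sigma>)"
  proof
    fix C assume "C \<in> rcosets\<^bsub>G_monoid\<^esub> G'"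
    then obtain g where g: "g \<in> G" "C = G' #>\<^bsub>G_monoid\<^esub> g" by (auto simp: RCOSETS_def)
    define s where "s = (SOME h. h \<in> G \<and> eps \<sigma> h = eps \<sigma> g)"
    have s: "s \<in> G \<and> eps \<sigma> s = eps \<sigma> g"
      unfolding s_def by (rule someI[of _ g]) (use g in simp)
    have "C = G' #>\<^bsub>G_monoid\<^esub> (SOME h. h \<in> G \<and> eps \<sigma> h = eps \<sigma> g)"
      unfolding g(2) s_def[symmetric] by (rule coset_eq) (use g s in auto)
    then show "C \<in> (\<lambda>v. G' #>\<^bsub>G_monoid\<^esub> (SOME g. g \<in> G \<and> eps \<sigma> g = v)) ` carrier (A_group \<sigma>)"
      using eps_closed[OF g(1)] by blast
  qed
  ultimately show ?thesis by (rule finite_surj)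
qed

lemma inv_id [simp]: "inv\<^bsub>Aut_tree\<^esub> (id :: 'x list \<Rightarrow> 'x list) = id"
  using aut.inv_one by simp

lemma inv_comp:
  assumes "g \<in> carrier (Aut_tree :: ('x list \<Rightarrow> 'x list) monoid)"
  shows "inv\<^bsub>Aut_tree\<^esub> g \<circ> g = id" "g \<circ> inv\<^bsub>Aut_tree\<^esub> g = id"
  using aut.l_inv[OF assms] aut.r_inv[OF assms] by simp_all

section \<open>The two directions\<close>

abbreviation antidiagonal where
  "antidiagonal p q h \<equiv> (\<lambda>_. id)(p := h, q := inv\<^bsub>Aut_tree\<^esub> h)"

lemma antidiagonal_in_G: "h \<in> G \<Longrightarrow> antidiagonal p q h x \<in> G"
  using G_inv G_id by simp

lemma J_group_subset_iff:
  "J_group G \<subseteq> G \<longleftrightarrow> (\<forall>h\<in>G. \<forall>p q. p \<noteq> q \<longrightarrow> tuple (antidiagonal p q h) \<in> G)"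
proof
  assume J: "J_group G \<subseteq> G"
  show "\<forall>h\<in>G. \<forall>p q. p \<noteq> q \<longrightarrow> tuple (antidiagonal p q h) \<in> G"
  proof (intro ballI allI impI)
    fix h p q assume h: "h \<in> G" "p \<noteq> (q :: 'x)"
    have k: "antidiagonal p q h x \<in> carrier Aut_tree" for x
      by (rule G_subset[OF antidiagonal_in_G[OF h(1)]])
    have "\<exists>h'\<in>G. \<exists>p' q'. p' \<noteq> q' \<and> psi (tuple (antidiagonal p q h)) = (antidiagonal p' q' h', id)"
      by (rule bexI[OF _ h(1)], rule exI[of _ p], rule exI[of _ q]) (intro conjI h(2) psi_tuple k)
    then have "tuple (antidiagonal p q h) \<in> J_group G"
      unfolding J_group_def by (intro generate.incl CollectI conjI tuple_in_St1[OF k])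
    then show "tuple (antidiagonal p q h) \<in> G" by (rule subsetD[OF J])
  qed
next
  assume anti: "\<forall>h\<in>G. \<forall>p q. p \<noteq> q \<longrightarrow> tuple (antidiagonal p q h) \<in> G"
  show "J_group G \<subseteq> G"
    unfolding J_group_def
  proof (rule aut.generate_subgroup_incl[OF _ subgroup_G], rule subsetI)
    fix g assume "g \<in> {g \<in> St1. \<exists>h\<in>G. \<exists>p q. p \<noteq> q \<and> psi g = (antidiagonal p q h, id)}"
    then obtain h p q where g: "g \<in> St1" "psi g = (antidiagonal p q h, id)" and "h \<in> G" "p \<noteq> q"
      by (elim CollectE conjE bexE exE)
    then show "g \<in> G" using anti unfolding St1_eq_tupleI[OF g] by simp
  qed
qed

text \<open>
  A letter \<open>y\<close> moved by \<open>\<sigma>\<^sub>p\<close> and its image are distinct, and neither of them is the fixed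
  point \<open>p\<close>.
\<close>

lemma ex_third_letter:
  fixes p q :: 'x
  obtains r where "r \<noteq> p" "r \<noteq> q"
proof -
  obtain y where y: "\<sigma> p y \<noteq> y" using sigma_neq_id[of p] by (auto simp: fun_eq_iff)
  then have "y \<noteq> p" using sigma_fix by metis
  moreover have "\<sigma> p y \<noteq> p"
    using bij_is_inj[OF bij_sigma[of p]] sigma_fix[of p] \<open>y \<noteq> p\<close> by (metis injD)
  ultimately show ?thesis using y that by metis
qed

text \<open>
  With \<open>p\<close>, \<open>q\<close>, \<open>r\<close> distinct, the antidiagonal elements of \<open>h\<close> at \<open>p, q\<close> and of \<open>k\<close> at
  \<open>p, r\<close> interact only at \<open>p\<close>. Their commutator is therefore \<open>[h,k]\<close> placed at \<open>p\<close>, and since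
  placing at \<open>p\<close> is a homomorphism, the claim passes from commutators to all of \<open>G'\<close>.
\<close>

lemma single_in_G':
  assumes anti: "\<And>h p q. h \<in> G \<Longrightarrow> p \<noteq> q \<Longrightarrow> tuple (antidiagonal p q h) \<in> G"
    and "g \<in> G'"
  shows "tuple ((\<lambda>_. id)(p := g)) \<in> G'"
proof -
  have G'_G: "x \<in> carrier Aut_tree" if "x \<in> G'" for x
    using that subgroup.mem_carrier[OF subgroup_G'] by blast
  have single: "((\<lambda>_. id)(p := x)) z \<in> carrier Aut_tree" if "x \<in> carrier Aut_tree" for x z
    using that by (simp add: id_in_Aut_tree)
  obtain q where q: "q \<noteq> p" using ex_third_letter[of p p] by metis
  obtain r where r: "r \<noteq> p" "r \<noteq> q" using ex_third_letter[of p q] by metis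
  have comm: "tuple ((\<lambda>_. id)(p := c)) \<in> G'" if c_comm: "c \<in> derived_set Aut_tree G" for c
  proof -
    obtain h k where hk: "h \<in> G" "k \<in> G"
      and c: "c = inv\<^bsub>Aut_tree\<^esub> k \<circ> (inv\<^bsub>Aut_tree\<^esub> h \<circ> (k \<circ> h))"
      using c_comm by auto
    let ?u = "antidiagonal p q h" and ?v = "antidiagonal p r k"
    have u: "?u z \<in> carrier Aut_tree" for z by (rule G_subset[OF antidiagonal_in_G[OF hk(1)]])
    have v: "?v z \<in> carrier Aut_tree" for z by (rule G_subset[OF antidiagonal_in_G[OF hk(2)]])
    have hk': "h \<in> carrier Aut_tree" "k \<in> carrier Aut_tree" using hk G_subset by auto
    have "tuple ?u \<otimes>\<^bsub>Aut_tree\<^esub> tuple ?v \<otimes>\<^bsub>Aut_tree\<^esub> inv\<^bsub>Aut_tree\<^esub> tuple ?u \<otimes>\<^bsub>Aut_tree\<^esub> inv\<^bsub>Aut_tree\<^esub> tuple ?v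
        \<in> derived_set Aut_tree G"
      using anti[OF hk(1), of p q] anti[OF hk(2), of p r] q r by blast
    moreover have "tuple ?u \<otimes>\<^bsub>Aut_tree\<^esub> tuple ?v \<otimes>\<^bsub>Aut_tree\<^esub> inv\<^bsub>Aut_tree\<^esub> tuple ?u \<otimes>\<^bsub>Aut_tree\<^esub> inv\<^bsub>Aut_tree\<^esub> tuple ?v
        = tuple (\<lambda>z. inv\<^bsub>Aut_tree\<^esub> (?v z) \<circ> (inv\<^bsub>Aut_tree\<^esub> (?u z) \<circ> (?v z \<circ> ?u z)))"
      by (simp only: inv_tuple[OF u] inv_tuple[OF v] mult_Aut_tree tuple_comp)
    moreover have "(\<lambda>z. inv\<^bsub>Aut_tree\<^esub> (?v z) \<circ> (inv\<^bsub>Aut_tree\<^esub> (?u z) \<circ> (?v z \<circ> ?u z))) = (\<lambda>_. id)(p := c)"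
    proof
      fix z
      show "inv\<^bsub>Aut_tree\<^esub> (?v z) \<circ> (inv\<^bsub>Aut_tree\<^esub> (?u z) \<circ> (?v z \<circ> ?u z)) = ((\<lambda>_. id)(p := c)) z"
        using q r hk' by (simp add: c inv_comp)
    qed
    ultimately show ?thesis
      unfolding derived_def by (intro generate.incl) simp
  qed
  have "tuple ((\<lambda>_. id)(p := g)) \<in> G'" if "g \<in> generate Aut_tree (derived_set Aut_tree G)"
    using that
  proof induction
    case one
    have eq: "(\<lambda>_. id)(p := id) = (\<lambda>_. id :: 'x list \<Rightarrow> 'x list)" by auto
    show ?case using subgroup.one_closed[OF subgroup_G'] unfolding one_Aut_tree eq tuple_id .
  next
    case (incl c) then show ?case by (rule comm)
  next
    case (inv c)
    have "c \<in> G'" unfolding derived_def using inv by (rule generate.incl)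
    then have "inv\<^bsub>Aut_tree\<^esub> tuple ((\<lambda>_. id)(p := c)) = tuple (\<lambda>z. inv\<^bsub>Aut_tree\<^esub> (((\<lambda>_. id)(p := c)) z))"
      by (intro inv_tuple single G'_G)
    also have "(\<lambda>z. inv\<^bsub>Aut_tree\<^esub> (((\<lambda>_. id)(p := c)) z)) = (\<lambda>_. id)(p := inv\<^bsub>Aut_tree\<^esub> c)"
      by auto
    finally show ?case
      using subgroup.m_inv_closed[OF subgroup_G' comm[OF inv]] by (simp only:)
  next
    case (eng x y)
    have eq: "(\<lambda>z. ((\<lambda>_. id)(p := y)) z \<circ> ((\<lambda>_. id)(p := x)) z) = (\<lambda>_. id)(p := y \<circ> x)"
      by auto
    show ?case
      using subgroup.m_closed[OF subgroup_G' eng.IH] unfolding mult_Aut_tree tuple_comp eq .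
  qed
  then show ?thesis using assms(2) by (simp add: derived_def)
qed

lemma tuple_in_G':
  assumes single: "\<And>g p. g \<in> G' \<Longrightarrow> tuple ((\<lambda>_. id)(p := g)) \<in> G'"
    and k: "\<And>x. k x \<in> G'"
  shows "tuple k \<in> G'"
proof -
  have "tuple (\<lambda>x. if x \<in> S then k x else id) \<in> G'" if "finite S" for S
    using that
  proof (induction S)
    case empty
    then show ?case
      using subgroup.one_closed[OF subgroup_G'] by (simp add: tuple_id[unfolded id_def] id_def)
  next
    case (insert p S)
    have eq: "(\<lambda>x. ((\<lambda>_. id)(p := k p)) x \<circ> (if x \<in> S then k x else id)) =
          (\<lambda>x. if x \<in> insert p S then k x else id)"
      using insert.hyps by auto
    show ?case
      using subgroup.m_closed[OF subgroup_G' insert.IH single[OF k[of p], of p]]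
      unfolding mult_Aut_tree tuple_comp eq .
  qed
  from this[of UNIV] show ?thesis by simp
qed

lemma D_group_eq: "D_group \<sigma> =
    {v. (\<forall>x. v x \<in> carrier (A_group \<sigma>)) \<and> finprod (A_group \<sigma>) v UNIV = \<one>\<^bsub>A_group \<sigma>\<^esub>}"
  by (auto simp: D_group_def kernel_def PiE_UNIV_domain)

lemma Psi_tuple:
  assumes "\<And>x. k x \<in> carrier Aut_tree"
  shows "Psi \<sigma> (tuple k) = ((\<lambda>x. eps \<sigma> (k x)), id)"
proof -
  have "section_at (tuple k) [x] = k x" for x
    using psi_tuple[of k, OF assms] by (auto simp: psi_def dest: fun_cong)
  moreover have "root_perm (tuple k) = id"
    using psi_tuple[of k, OF assms] by (simp add: psi_def)
  ultimately show ?thesis by (simp add: Psi_def)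
qed

text \<open>
  The coordinates of \<open>v\<close> are realized one after the other, the balancing entries being collected
  in one fixed coordinate \<open>p\<close>. Once all other coordinates are right, so is the one at \<open>p\<close>, because
  the sum over all coordinates is trivial for \<open>v\<close> and for the element constructed.
\<close>

lemma antidiagonals_imp_D:
  assumes anti: "\<And>h p q. h \<in> G \<Longrightarrow> p \<noteq> q \<Longrightarrow> tuple (antidiagonal p q h) \<in> G"
    and "v \<in> D_group \<sigma>"
  shows "(v, id) \<in> Psi \<sigma> ` (G \<inter> St1)"
proof -
  have v: "v x \<in> carrier (A_group \<sigma>)" for x using assms(2) by (simp add: D_group_eq)
  fix p :: 'x
  have "\<exists>k. (\<forall>x. k x \<in> G) \<and> tuple k \<in> G \<and> (\<forall>x. x \<noteq> p \<longrightarrow> eps \<sigma> (k x) = (if x \<in> S then v x else \<one>\<^bsub>A_group \<sigma>\<^esub>)) \<and>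
          eps \<sigma> (k p) = inv\<^bsub>A_group \<sigma>\<^esub> finprod (A_group \<sigma>) v S" if "finite S" "p \<notin> S" for S
    using that
  proof (induction S)
    case empty
    then show ?case by (intro exI[of _ "\<lambda>_. id"]) (simp add: G_id[unfolded id_def] eps_id[unfolded id_def] tuple_id[unfolded id_def] id_def)
  next
    case (insert q S)
    then obtain k where k: "\<And>x. k x \<in> G" "tuple k \<in> G"
      "\<And>x. x \<noteq> p \<Longrightarrow> eps \<sigma> (k x) = (if x \<in> S then v x else \<one>\<^bsub>A_group \<sigma>\<^esub>)"
      "eps \<sigma> (k p) = inv\<^bsub>A_group \<sigma>\<^esub> finprod (A_group \<sigma>) v S"
      by auto
    have pq: "p \<noteq> q" using insert.prems by auto
    obtain h where h: "h \<in> G" "eps \<sigma> h = v q" using eps_surj[OF v] by metis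
    define l where "l = (\<lambda>x. antidiagonal q p h x \<circ> k x)"
    have "\<forall>x. l x \<in> G"
      unfolding l_def by (intro allI G_comp[OF k(1) antidiagonal_in_G[OF h(1)]])
    moreover have "tuple l \<in> G"
      using G_comp[OF k(2) anti[OF h(1), of q p]] pq by (simp add: tuple_comp l_def)
    moreover have "eps \<sigma> (l x) = (if x \<in> insert q S then v x else \<one>\<^bsub>A_group \<sigma>\<^esub>)" if "x \<noteq> p" for x
      using that k(3)[OF that] k(1)[of x] eps_comp[OF k(1)[of x] h(1)] h insert.hyps v
      by (auto simp: l_def)
    moreover have "eps \<sigma> (l p) = inv\<^bsub>A_group \<sigma>\<^esub> finprod (A_group \<sigma>) v (insert q S)"
    proof -
      have "eps \<sigma> (l p) = inv\<^bsub>A_group \<sigma>\<^esub> finprod (A_group \<sigma>) v S \<otimes>\<^bsub>A_group \<sigma>\<^esub> inv\<^bsub>A_group \<sigma>\<^esub> v q"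
        using eps_comp[OF k(1)[of p] G_inv[OF h(1)]] k(4) h by (simp add: l_def eps_inv)
      also have "\<dots> = inv\<^bsub>A_group \<sigma>\<^esub> finprod (A_group \<sigma>) v (insert q S)"
        using insert.hyps v by (simp add: A.inv_mult A.m_comm)
      finally show ?thesis .
    qed
    ultimately show ?case by blast
  qed
  from this[of "UNIV - {p}"] obtain k where k: "\<And>x. k x \<in> G" "tuple k \<in> G"
      "\<And>x. x \<noteq> p \<Longrightarrow> eps \<sigma> (k x) = v x"
      "eps \<sigma> (k p) = inv\<^bsub>A_group \<sigma>\<^esub> finprod (A_group \<sigma>) v (UNIV - {p})"
    by auto
  have "finprod (A_group \<sigma>) v (insert p (UNIV - {p})) = v p \<otimes>\<^bsub>A_group \<sigma>\<^esub> finprod (A_group \<sigma>) v (UNIV - {p})"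
    by (rule A.finprod_insert) (use v in auto)
  moreover have "insert p (UNIV - {p}) = UNIV" by auto
  ultimately have "v p \<otimes>\<^bsub>A_group \<sigma>\<^esub> finprod (A_group \<sigma>) v (UNIV - {p}) = \<one>\<^bsub>A_group \<sigma>\<^esub>"
    using assms(2) by (simp add: D_group_eq)
  then have "inv\<^bsub>A_group \<sigma>\<^esub> finprod (A_group \<sigma>) v (UNIV - {p}) = v p"
    using v by (intro A.inv_equality) (auto intro: A.finprod_closed)
  then have "(\<lambda>x. eps \<sigma> (k x)) = v" using k(3,4) by force
  moreover have "k x \<in> carrier Aut_tree" for x using k(1) G_subset by blast
  ultimately show ?thesis
    using k(2) tuple_in_St1[of k] Psi_tuple[of k] by (intro image_eqI[of _ _ "tuple k"]) auto
qed

lemma antidiagonal_in_D: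
  assumes "h \<in> G" "p \<noteq> q"
  shows "(\<lambda>x. eps \<sigma> (antidiagonal p q h x)) \<in> D_group \<sigma>"
proof -
  let ?e = "eps \<sigma> h"
  have e: "?e \<in> carrier (A_group \<sigma>)" using eps_closed[OF assms(1)] .
  have eps_anti: "(\<lambda>x. eps \<sigma> (antidiagonal p q h x)) =
    (\<lambda>x. (if p = x then ?e else \<one>\<^bsub>A_group \<sigma>\<^esub>) \<otimes>\<^bsub>A_group \<sigma>\<^esub> (if q = x then inv\<^bsub>A_group \<sigma>\<^esub> ?e else \<one>\<^bsub>A_group \<sigma>\<^esub>))"
  proof
    fix x
    show "eps \<sigma> (antidiagonal p q h x) =
      (if p = x then ?e else \<one>\<^bsub>A_group \<sigma>\<^esub>) \<otimes>\<^bsub>A_group \<sigma>\<^esub> (if q = x then inv\<^bsub>A_group \<sigma>\<^esub> ?e else \<one>\<^bsub>A_group \<sigma>\<^esub>)"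
      using assms(2) e by (auto simp: eps_id eps_inv[OF assms(1)])
  qed
  have p: "finprod (A_group \<sigma>) (\<lambda>x. if p = x then ?e else \<one>\<^bsub>A_group \<sigma>\<^esub>) UNIV = ?e"
    using e by (intro A.finprod_singleton) auto
  have q: "finprod (A_group \<sigma>) (\<lambda>x. if q = x then inv\<^bsub>A_group \<sigma>\<^esub> ?e else \<one>\<^bsub>A_group \<sigma>\<^esub>) UNIV = inv\<^bsub>A_group \<sigma>\<^esub> ?e"
    using e by (intro A.finprod_singleton) auto
  have "finprod (A_group \<sigma>) (\<lambda>x. eps \<sigma> (antidiagonal p q h x)) UNIV =
      finprod (A_group \<sigma>) (\<lambda>x. if p = x then ?e else \<one>\<^bsub>A_group \<sigma>\<^esub>) UNIV \<otimes>\<^bsub>A_group \<sigma>\<^esub>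
      finprod (A_group \<sigma>) (\<lambda>x. if q = x then inv\<^bsub>A_group \<sigma>\<^esub> ?e else \<one>\<^bsub>A_group \<sigma>\<^esub>) UNIV"
    unfolding eps_anti using e by (intro A.finprod_multf) auto
  also have "\<dots> = \<one>\<^bsub>A_group \<sigma>\<^esub>" unfolding p q by (rule A.r_inv[OF e])
  finally show ?thesis
    unfolding D_group_eq by (intro CollectI conjI allI eps_closed antidiagonal_in_G assms(1))
qed

text \<open>
  Some \<open>g \<in> St\<^sub>G(1)\<close> has the same image under \<open>\<Psi>\<close> as the antidiagonal element. Their quotient
  \<open>tuple m\<close> has sections in the kernel of \<open>\<epsilon>\<close>, hence in \<open>G'\<close>, so the branching condition provides
  it in \<open>G\<close>.
\<close>

lemma D_imp_antidiagonals:
  assumes branch: "(UNIV \<rightarrow> G') \<times> {id} \<subseteq> psi ` (G' \<inter> St1)"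
    and D: "D_group \<sigma> \<times> {id} \<subseteq> Psi \<sigma> ` (G \<inter> St1)"
    and h: "h \<in> G" "p \<noteq> q"
  shows "tuple (antidiagonal p q h) \<in> G"
proof -
  let ?k = "antidiagonal p q h"
  have kG: "?k x \<in> G" for x by (rule antidiagonal_in_G[OF h(1)])
  obtain g where g: "g \<in> G" "g \<in> St1" "Psi \<sigma> g = ((\<lambda>x. eps \<sigma> (?k x)), id)"
    using D antidiagonal_in_D[OF h] by force
  define l where "l = (\<lambda>x. section_at g [x])"
  have lG: "l x \<in> G" for x using section_in_G[OF g(1)] by (simp add: l_def)
  have g_tuple: "g = tuple l" using St1_eq_tuple[OF g(2)] by (simp add: l_def)
  have eps_l: "eps \<sigma> (l x) = eps \<sigma> (?k x)" for x
  proof -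
    have "(\<lambda>x. eps \<sigma> (l x)) = (\<lambda>x. eps \<sigma> (?k x))"
      using g(3) unfolding Psi_def l_def by (rule Pair_inject)
    then show ?thesis by (rule fun_cong)
  qed
  define m where "m = (\<lambda>x. ?k x \<circ> inv\<^bsub>Aut_tree\<^esub> (l x))"
  have "m x \<in> G'" for x
  proof (rule eps_trivial_imp_G')
    show "m x \<in> G" unfolding m_def by (rule G_comp[OF G_inv[OF lG] kG])
    have "eps \<sigma> (m x) = inv\<^bsub>A_group \<sigma>\<^esub> eps \<sigma> (l x) \<otimes>\<^bsub>A_group \<sigma>\<^esub> eps \<sigma> (?k x)"
      unfolding m_def eps_comp[OF G_inv[OF lG] kG] eps_inv[OF lG] ..
    then show "eps \<sigma> (m x) = \<one>\<^bsub>A_group \<sigma>\<^esub>"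
      unfolding eps_l using A.l_inv[OF eps_closed[OF kG]] by simp
  qed
  then have "(m, id) \<in> psi ` (G' \<inter> St1)" using branch by blast
  then have "tuple m \<in> G" using St1_eq_tupleI G'_subset_G by force
  moreover have "tuple m \<circ> tuple l = tuple ?k"
    unfolding tuple_comp m_def comp_assoc inv_comp(1)[OF G_subset[OF lG]]
    by (simp only: comp_id)
  ultimately show ?thesis using G_comp[OF g(1)] g_tuple by metis
qed

end

theorem lemma4p11:
  fixes \<sigma> :: "'x::finite \<Rightarrow> 'x \<Rightarrow> 'x"
    and G :: "('x list \<Rightarrow> 'x list) set"
  assumes "spinal_hanoi_data \<sigma>"
    and "G = hanoi_group \<sigma>"
    and "level_transitive G"
  shows "J_group G \<subseteq> G \<longleftrightarrow>
           regular_branch_over G (derived Aut_tree G) \<and>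
           D_group \<sigma> \<times> {id} \<subseteq> Psi \<sigma> ` (G \<inter> St1)"
proof -
  interpret H: spinal_hanoi \<sigma> by unfold_locales (rule assms(1))
  show ?thesis
    unfolding assms(2)
  proof
    assume J: "J_group H.G \<subseteq> H.G"
    have anti: "tuple (H.antidiagonal p q h) \<in> H.G" if "h \<in> H.G" "p \<noteq> q" for h p q
      using J[unfolded H.J_group_subset_iff] that by simp
    have "(UNIV \<rightarrow> H.G') \<times> {id} \<subseteq> psi ` (H.G' \<inter> St1)"
    proof clarify
      fix k :: "'x \<Rightarrow> 'x list \<Rightarrow> 'x list" assume k: "k \<in> UNIV \<rightarrow> H.G'"
      have kG': "k x \<in> H.G'" for x using k by blast
      have k_Aut: "k x \<in> carrier Aut_tree" for x
        by (rule subgroup.mem_carrier[OF H.subgroup_G' kG'])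
      have "tuple ((\<lambda>_. id)(p := g)) \<in> H.G'" if "g \<in> H.G'" for g p
        by (rule H.single_in_G'[OF anti that])
      then have "tuple k \<in> H.G'" using kG' by (rule H.tuple_in_G')
      then show "(k, id) \<in> psi ` (H.G' \<inter> St1)"
        by (intro image_eqI[of _ _ "tuple k"] IntI psi_tuple[OF k_Aut, symmetric] tuple_in_St1[OF k_Aut])
    qed
    then have "regular_branch_over H.G H.G'"
      unfolding regular_branch_over_def
      using assms(2,3) H.finite_rcosets_G' normal_imp_subgroup[OF H.normal_G'] by simp
    moreover have "D_group \<sigma> \<times> {id} \<subseteq> Psi \<sigma> ` (H.G \<inter> St1)"
      using H.antidiagonals_imp_D[OF anti] by blast
    ultimately show "regular_branch_over H.G H.G' \<and> D_group \<sigma> \<times> {id} \<subseteq> Psi \<sigma> ` (H.G \<inter> St1)" ..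
  next
    assume "regular_branch_over H.G H.G' \<and> D_group \<sigma> \<times> {id} \<subseteq> Psi \<sigma> ` (H.G \<inter> St1)"
    then have "(UNIV \<rightarrow> H.G') \<times> {id} \<subseteq> psi ` (H.G' \<inter> St1)"
      and "D_group \<sigma> \<times> {id} \<subseteq> Psi \<sigma> ` (H.G \<inter> St1)"
      by (simp_all only: regular_branch_over_def)
    then show "J_group H.G \<subseteq> H.G"
      unfolding H.J_group_subset_iff by (intro ballI allI impI H.D_imp_antidiagonals)
  qed
qed

end
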